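(* Put $q=e^{\hbar}$ and let the generators of the algebra $\mathcal{SV}ir_{q,k}$ in the sector ${\rm A}$ (${\rm A}={\rm NS}$ or ${\rm R}$) be expanded in non-negative powers of $\hbar$ as described in the context. Let $D=z\frac{\partial}{\partial z}$, so that $(D^j\delta^{\rm A})(z)=\sum_{m\in\mathbb Z^{\rm A}}m^jz^m$ and $(D^j\delta)(z)=\sum_{m\in\mathbb Z}m^jz^m$. Define $$\mathsf G^\pm(z)=\sqrt{\tfrac{2}{k+2}}\,G^{\pm(0)}(z),\qquad \mathsf I(z)=\frac{1}{2(k+2)}K^{(1)}(z),$$ $$\mathsf L(z)=\frac{1}{4(k+2)}T^{(2)}(z)+\frac{1}{4(k+1)(k+2)}K^{(2)}(z)+\frac{k(2k+1)}{24(k+1)(k+2)}.$$ Then $\mathsf G^\pm(z),\mathsf I(z),\mathsf L(z)$ satisfy the relations of the $\mathcal N=2$ superconformal algebra with central charge $c=\frac{3k}{k+2}$, namely $$\{\mathsf G^\pm(z),\mathsf G^\pm(w)\}=0,$$ $$\{\mathsf G^+(z),\mathsf G^-(w)\}=2\delta^{\rm A}\!\left(\tfrac wz\right)\mathsf L(w)+(D\delta^{\rm A})\!\left(\tfrac wz\right)\bigl(\mathsf I(w)+\mathsf I(z)\bigr)+\frac c3\Bigl((D^2\delta^{\rm A})\!\left(\tfrac wz\right)-\tfrac14\delta^{\rm A}\!\left(\tfrac wz\right)\Bigr),$$ $$[\mathsf L(z),\mathsf G^\pm(w)]=\tfrac12(D\delta)\!\left(\tfrac wz\right)\mathsf G^\pm(w)+(D\delta^{\rm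 A})\!\left(\tfrac wz\right)\mathsf G^\pm(z),$$ $$[\mathsf I(z),\mathsf G^\pm(w)]=\pm\delta\!\left(\tfrac wz\right)\mathsf G^\pm(w),\qquad [\mathsf I(z),\mathsf I(w)]=\frac c3(D\delta)\!\left(\tfrac wz\right),\qquad [\mathsf I(z),\mathsf L(w)]=(D\delta)\!\left(\tfrac wz\right)\mathsf I(w),$$ $$[\mathsf L(z),\mathsf L(w)]=(D\delta)\!\left(\tfrac wz\right)\bigl(\mathsf L(z)+\mathsf L(w)\bigr)+\frac c{12}\Bigl((D^3\delta)\!\left(\tfrac wz\right)-(D\delta)\!\left(\tfrac wz\right)\Bigr).$$
   Context: Conventions. $k$ is a generic complex number (in particular $k\ne -2$), $q$ is generic, and $[u]=(q^u-q^{-u})/(q-q^{-1})$. $\mathbb Z^{\rm R}=\mathbb Z$, $\mathbb Z^{\rm NS}=\mathbb Z+\frac12$. $\delta^{\rm A}(z)=\sum_{m\in\mathbb Z^{\rm A}}z^m$ and $\delta(z)=\delta^{\rm R}(z)$. $[\,,]$ is the commutator, $\{\,,\}$ the anticommutator. The algebra $\mathcal{SV}ir_{q,k}$ in the sector A is the unital associative algebra with generators $K^\pm_m$ ($\pm m\ge0$), $T_m$ ($m\in\mathbb Z$), $G^\pm_m$ ($m\in\mathbb Z^{\rm A}$), with $K_0^+=K_0^-$ invertible. Put $K^\pm(z)=\sum_{\pm m\ge0}K^\pm_mz^{-m}$, $T(z)=\sum_{m\in\mathbb Z}T_mz^{-m}$, $G^\pm(z)=\sum_{m\in\mathbb Z^{\rm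 A}}G^\pm_mz^{-m}$, $K(z)=K^-(z)K^+(z)$. The relations (infinite sums being understood formally, and rational factors expanded in $|z|\ll|w|$) are: $K^\pm(z)K^\pm(w)=K^\pm(w)K^\pm(z)$; $K^-(z)K^+(w)=\frac{(1-q^{2k+2}z/w)(1-q^{-2k-2}z/w)}{(1-q^2z/w)(1-q^{-2}z/w)}K^+(w)K^-(z)$; $K^-(z)T(w)=\frac{(1-q^{k+1}z/w)(1-q^{-k-1}z/w)}{(1-q^{k+3}z/w)(1-q^{-k-3}z/w)}T(w)K^-(z)$; $T(z)K^+(w)=\frac{(1-q^{k+1}z/w)(1-q^{-k-1}z/w)}{(1-q^{k+3}z/w)(1-q^{-k-3}z/w)}K^+(w)T(z)$; $K^-(z)G^\pm(w)=q^{\pm(k+2)}\frac{1-z/w}{1-q^{\pm2(k+2)}z/w}G^\pm(w)K^-(z)$; $G^\pm(z)K^+(w)=q^{\mp(k+2)}\frac{1-z/w}{1-q^{\mp2(k+2)}z/w}K^+(w)G^\pm(z)$; $G^\pm(z)G^\pm(w)+G^\pm(w)G^\pm(z)=0$; $G^+(z)G^-(w)+G^-(w)G^+(z)=\frac1{(q-q^{-1})^2}\bigl(\delta^{\rm A}(q^{4(k+1)}\frac wz)\frac1{[k+1]}K(q^{2(k+1)}w)-\delta^{\rm A}(q^{2(k+2)}\frac wz)+\delta^{\rm A}(q^{2(k+1)}\frac wz)T(q^{k+1}w)\bigr)$; $G^\pm(z)T(w)-T(w)G^\pm(z)=\pm(q-q^{-1})\frac{[k+2]}{[k+1]}\delta^{\rm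 A}(q^{\pm3(k+1)}\frac wz)K^-(q^{\pm(k+1)}w)G^\pm(q^{\pm(k+1)}w)K^+(q^{\pm(k+1)}w)$; $T(z)T(w)-T(w)T(z)=(q-q^{-1})\frac{[k+2]^2}{[k+1]}\bigl(\delta(q^{2(k+1)}\frac wz)K^-(q^{k+1}w)W(q^{k+1}w)K^+(q^{k+1}w)-\delta(q^{-2(k+1)}\frac wz)K^-(q^{-k-1}w)W(q^{-k-1}w)K^+(q^{-k-1}w)\bigr)$. Here $W(z)=\sum_mW_mz^{-m}$ with $W_m=\sum_{\mu,\nu\ge0}c^{\rm A}_m(2k+2)\delta_{m+\mu-\nu,0}\frac1{[k+1]}K^-_{-\mu}K^+_\nu-c^{\rm A}_m(k+2)\delta_{m,0}+c^{\rm A}_m(k+1)T_m-(q-q^{-1})^3\sum_{\gamma\in\mathbb Z^{\rm A}}N(G^+_{-\gamma}G^-_{m+\gamma})$, where $c^{\rm NS}_\alpha(u)=\frac1{[u]}$ for $\alpha$ even and $\frac1{[u]}\frac{q^u+q^{-u}}2$ for $\alpha$ odd; $c^{\rm R}_\alpha(u)=\frac1{[u]}\frac{q^u+q^{-u}}2$ for $\alpha$ even and $\frac1{[u]}$ for $\alpha$ odd; and $N(G^+_mG^-_n)$ equals $G^+_mG^-_n$ if $m<n$, $\frac12(G^+_mG^-_m-G^-_mG^+_m)$ if $m=n$, and $-G^-_nG^+_m$ if $m>n$. $\hbar$-expansions. It is assumed that with $q=e^\hbar$ the generators are expanded in non-negative powers of $\hbar$: $K^\pm_m=\sum_{i\ge0}\hbar^iK^{\pm(i)}_m$,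 $G^\pm_m=\sum_{i\ge0}\hbar^iG^{\pm(i)}_m$, $T_m=\sum_{i\ge0}\hbar^iT^{(i)}_m$, with coefficients independent of $\hbar$. Moreover, writing $K^\pm_0=q^{H_0}$ and $\exp\bigl((q-q^{-1})\sum_{m>0}H_{\pm m}z^{\mp m}\bigr)=(K_0^\pm)^{-1}K^\pm(z)$, it is assumed that $H_0$ does not depend on $\hbar$ and that $H_m=\sum_{i\ge0}\hbar^iH_m^{(i)}$ for $m\ne0$. The defining relations hold order by order in $\hbar$. Write $G^{\pm(i)}(z)=\sum_{m\in\mathbb Z^{\rm A}}G^{\pm(i)}_mz^{-m}$, $T^{(i)}(z)=\sum_{m}T^{(i)}_mz^{-m}$, and $K(z)=K^-(z)K^+(z)=\sum_{i\ge0}\hbar^iK^{(i)}(z)$. *)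

theory Defs
  imports "HOL-Analysis.Infinite_Sum" "HOL-Computational_Algebra.Formal_Power_Series"
begin

unbundle fps_syntax

section \<open>The coefficient algebra\<close>

class complex_algebra_1 = ring_1 +
  fixes scaleC :: "complex \<Rightarrow> 'a \<Rightarrow> 'a" (infixr "*\<^sub>C" 75)
  assumes scaleC_add_right: "c *\<^sub>C (x + y) = c *\<^sub>C x + c *\<^sub>C y"
    and scaleC_add_left: "(c + d) *\<^sub>C x = c *\<^sub>C x + d *\<^sub>C x"
    and scaleC_scaleC: "c *\<^sub>C d *\<^sub>C x = (c * d) *\<^sub>C x"
    and scaleC_one: "1 *\<^sub>C x = x"
    and mult_scaleC_left: "(c *\<^sub>C x) * y = c *\<^sub>C (x * y)"
    and mult_scaleC_right: "x * (c *\<^sub>C y) = c *\<^sub>C (x * y)"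

text \<open>
  The coefficients of the expansions in powers of the deformation parameter live in an arbitrary
  unital associative complex algebra. Some relations contain infinite sums of products of
  generators; to give them a meaning, the algebra carries a Hausdorff topology for which the
  addition is continuous and the multiplication is separately continuous, and infinite sums are
  unconditionally convergent sums. Neither completeness nor joint continuity of the
  multiplication is required. Examples are the endomorphisms of a vector space with the topology
  of pointwise convergence, where summable means locally finite.
\<close>

class complex_topological_algebra = complex_algebra_1 + topological_ab_group_add + t2_space +
  assumes tendsto_mult_left_nhds: "filterlim (\<lambda>x. a * x) (nhds (a * b)) (nhds b)"
    and tendsto_mult_right_nhds: "filterlim (\<lambda>x. x * a) (nhds (b * a)) (nhds b)"


section \<open>Power series in the deformation parameter\<close>

text \<open>
  \<^typ>\<open>complex fps\<close> and \<^typ>\<open>'a fps\<close> are scalars and algebra elements expanded in non-negative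
  powers of \<open>\<hbar>\<close>, where \<open>q = exp \<hbar>\<close>.
\<close>

definition qpow :: "complex \<Rightarrow> complex fps" where
  "qpow u = fps_exp u"

definition qdiff :: "complex fps" where
  "qdiff = qpow 1 - qpow (-1)"

text \<open>Numerator and denominator both have vanishing constant term; the quotient
  \<open>u + O(\<hbar>\<^sup>2)\<close> is a unit if \<open>u \<noteq> 0\<close>.\<close>

definition qint :: "complex \<Rightarrow> complex fps" where
  "qint u = (qpow u - qpow (-u)) / qdiff"

definition hscale :: "complex fps \<Rightarrow> 'a::complex_algebra_1 fps \<Rightarrow> 'a fps" (infixr "*\<^sub>h" 75) where
  "c *\<^sub>h x = Abs_fps (\<lambda>i. (c $ i) *\<^sub>C 1) * x"

text \<open>Infinite sums are taken order by order in \<open>\<hbar>\<close>.\<close>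

definition hsummable :: "('i \<Rightarrow> 'a::complex_topological_algebra fps) \<Rightarrow> 'i set \<Rightarrow> bool" where
  "hsummable f S \<longleftrightarrow> (\<forall>i. (\<lambda>x. f x $ i) summable_on S)"

definition hsum :: "('i \<Rightarrow> 'a::complex_topological_algebra fps) \<Rightarrow> 'i set \<Rightarrow> 'a fps" where
  "hsum f S = Abs_fps (\<lambda>i. infsum (\<lambda>x. f x $ i) S)"


section \<open>Formal series in the spectral parameters\<close>

datatype sector = NS | R

definition modes :: "sector \<Rightarrow> real set" where
  "modes A = (case A of R \<Rightarrow> \<int> | NS \<Rightarrow> (\<lambda>m. m + 1/2) ` \<int>)"

text \<open>
  A formal series \<open>X(z) = \<Sum>\<^sub>m X\<^sub>m z\<^bsup>-m\<^esup>\<close> is encoded by the function \<open>m \<mapsto> X\<^sub>m\<close> on the reals, which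
  vanishes outside the modes over which the sum runs. A series in two variables is encoded by
  the function \<open>(m, n) \<mapsto>\<close> coefficient of \<open>z\<^bsup>-m\<^esup> w\<^bsup>-n\<^esup>\<close>. In contrast, \<open>d(x) = \<Sum>\<^sub>m d\<^sub>m x\<^sup>m\<close> for
  the delta functions.
\<close>

type_synonym 'a series = "real \<Rightarrow> 'a"
type_synonym 'a series2 = "real \<Rightarrow> real \<Rightarrow> 'a"

definition one_series :: "'a::ring_1 series" where
  "one_series m = (if m = 0 then 1 else 0)"

text \<open>\<open>[X(z), Y(w)]\<close> and \<open>{X(z), Y(w)}\<close>\<close>

definition comm :: "'a::ring_1 series \<Rightarrow> 'a series \<Rightarrow> 'a series2" where
  "comm X Y m n = X m * Y n - Y n * X m"

definition acomm :: "'a::ring_1 series \<Rightarrow> 'a series \<Rightarrow> 'a series2" where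
  "acomm X Y m n = X m * Y n + Y n * X m"

text \<open>\<open>X(q\<^sup>b z)\<close>\<close>

definition dil :: "complex \<Rightarrow> 'a::complex_algebra_1 fps series \<Rightarrow> 'a fps series" where
  "dil b X m = qpow (- b * of_real m) *\<^sub>h X m"

text \<open>\<open>\<delta>\<^sup>S(q\<^sup>a x)\<close>, and \<open>d(w/z) X(w)\<close>\<close>

definition qdelta :: "real set \<Rightarrow> complex \<Rightarrow> complex fps series" where
  "qdelta S a m = (if m \<in> S then qpow (a * of_real m) else 0)"

definition qdelta_at_w :: "complex fps series \<Rightarrow> 'a::complex_algebra_1 fps series \<Rightarrow> 'a fps series2" where
  "qdelta_at_w d X m n = d m *\<^sub>h X (m + n)"

text \<open>\<open>(D\<^sup>j \<delta>\<^sup>S)(x)\<close>, and \<open>d(w/z) X(w)\<close>, \<open>d(w/z) X(z)\<close>\<close>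

definition Ddelta :: "real set \<Rightarrow> nat \<Rightarrow> complex series" where
  "Ddelta S j m = (if m \<in> S then of_real m ^ j else 0)"

definition at_w :: "complex series \<Rightarrow> 'a::complex_algebra_1 series \<Rightarrow> 'a series2" where
  "at_w d X m n = d m *\<^sub>C X (m + n)"

definition at_z :: "complex series \<Rightarrow> 'a::complex_algebra_1 series \<Rightarrow> 'a series2" where
  "at_z d X m n = d (- n) *\<^sub>C X (m + n)"

text \<open>
  \<open>f(z/w) Y(w) X(z)\<close> for a power series \<open>f\<close>, i.e. a rational function expanded in \<open>|z| \<lless> |w|\<close>.
  It is only used if \<open>X\<^sub>m = 0\<close> for all \<open>m > 0\<close> or \<open>Y\<^sub>n = 0\<close> for all \<open>n < 0\<close>, so that
  only finitely many terms are nonzero.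
\<close>

definition expand_zw :: "complex fps fps \<Rightarrow> 'a::complex_algebra_1 fps series \<Rightarrow> 'a fps series \<Rightarrow> 'a fps series2" where
  "expand_zw f Y X m n =
     (\<Sum>j | Y (n - real j) * X (m + real j) \<noteq> 0. (f $ j) *\<^sub>h (Y (n - real j) * X (m + real j)))"


section \<open>The structure functions\<close>

text \<open>\<open>1 - q\<^sup>a x\<close>\<close>

definition lin :: "complex \<Rightarrow> complex fps fps" where
  "lin a = 1 - fps_const (qpow a) * fps_X"

definition KK_factor :: "complex \<Rightarrow> complex fps fps" where
  "KK_factor k = lin (2*k+2) * lin (-2*k-2) * inverse (lin 2 * lin (-2))"

definition KT_factor :: "complex \<Rightarrow> complex fps fps" where
  "KT_factor k = lin (k+1) * lin (-k-1) * inverse (lin (k+3) * lin (-k-3))"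

text \<open>\<open>q\<^sup>u (1 - x) / (1 - q\<^bsup>2u\<^esup> x)\<close>\<close>

definition KG_factor :: "complex \<Rightarrow> complex fps fps" where
  "KG_factor u = fps_const (qpow u) * (1 - fps_X) * inverse (lin (2*u))"

definition c_coeff :: "sector \<Rightarrow> real \<Rightarrow> complex \<Rightarrow> complex fps" where
  "c_coeff A m u =
     (if (A = NS) = (m / 2 \<in> \<int>) then inverse (qint u)
      else inverse (qint u) * (fps_const (1/2) * (qpow u + qpow (-u))))"


section \<open>Composite series\<close>

text \<open>\<open>K(z) = K\<^sup>-(z) K\<^sup>+(z)\<close>\<close>

definition K_term :: "'a::complex_topological_algebra fps series \<Rightarrow> 'a fps series \<Rightarrow> nat \<times> nat \<Rightarrow> 'a fps" where
  "K_term Kp Km = (\<lambda>(\<mu>, \<nu>). Km (- real \<mu>) * Kp (real \<nu>))"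

definition K_index :: "real \<Rightarrow> (nat \<times> nat) set" where
  "K_index m = {(\<mu>, \<nu>). m + real \<mu> - real \<nu> = 0}"

definition K_series :: "'a::complex_topological_algebra fps series \<Rightarrow> 'a fps series \<Rightarrow> 'a fps series" where
  "K_series Kp Km m = hsum (K_term Kp Km) (K_index m)"

text \<open>\<open>K\<^sup>-(z) X(z) K\<^sup>+(z)\<close>\<close>

definition KXK_term :: "'a::complex_topological_algebra fps series \<Rightarrow> 'a fps series \<Rightarrow> 'a fps series
    \<Rightarrow> real \<Rightarrow> nat \<times> nat \<Rightarrow> 'a fps" where
  "KXK_term Kp Km X m = (\<lambda>(\<mu>, \<nu>). Km (- real \<mu>) * X (m + real \<mu> - real \<nu>) * Kp (real \<nu>))"

definition KXK_series :: "'a::complex_topological_algebra fps series \<Rightarrow> 'a fps series \<Rightarrow> 'a fps series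
    \<Rightarrow> 'a fps series" where
  "KXK_series Kp Km X m = hsum (KXK_term Kp Km X m) UNIV"

text \<open>\<open>N(G\<^sup>+\<^sub>m G\<^sup>-\<^sub>n)\<close>\<close>

definition N_GG :: "'a::complex_topological_algebra fps series \<Rightarrow> 'a fps series \<Rightarrow> 'a fps series2" where
  "N_GG Gp Gm m n =
     (if m < n then Gp m * Gm n
      else if m = n then fps_const (1/2) *\<^sub>h (Gp m * Gm m - Gm m * Gp m)
      else - (Gm n * Gp m))"

definition W_series :: "complex \<Rightarrow> sector \<Rightarrow> 'a::complex_topological_algebra fps series \<Rightarrow> 'a fps series
    \<Rightarrow> 'a fps series \<Rightarrow> 'a fps series \<Rightarrow> 'a fps series \<Rightarrow> 'a fps series" where
  "W_series k A Kp Km T Gp Gm m =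
       (c_coeff A m (2*k+2) * inverse (qint (k+1))) *\<^sub>h K_series Kp Km m
     - c_coeff A m (k+2) *\<^sub>h one_series m
     + c_coeff A m (k+1) *\<^sub>h T m
     - (qdiff ^ 3) *\<^sub>h hsum (\<lambda>\<gamma>. N_GG Gp Gm (- \<gamma>) (m + \<gamma>)) (modes A)"

text \<open>\<open>q\<^sup>x\<close> for an algebra element \<open>x\<close> not depending on \<open>\<hbar>\<close>\<close>

definition qpow_elem :: "'a::complex_algebra_1 \<Rightarrow> 'a fps" where
  "qpow_elem x = Abs_fps (\<lambda>i. (1 / fact i) *\<^sub>C x ^ i)"

text \<open>The exponential series of a power series without constant term, so that
  \<open>X\<^sup>n\<close> does not contribute to the coefficient \<open>m\<close> if \<open>n > m\<close>.\<close>

definition exp_series :: "'a::complex_algebra_1 fps fps \<Rightarrow> 'a fps fps" where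
  "exp_series X = Abs_fps (\<lambda>m. \<Sum>n\<le>m. fps_const (1 / fact n) *\<^sub>h ((X ^ n) $ m))"


section \<open>Expanded generators of the deformed algebra\<close>

text \<open>
  The generators are power series in \<open>\<hbar>\<close> and satisfy the defining relations order by order,
  the relations being compared coefficientwise in \<open>z\<^bsup>-m\<^esup> w\<^bsup>-n\<^esup>\<close>.
  The relation between \<open>G\<^sup>+\<close> and \<open>G\<^sup>-\<close> is multiplied by \<open>(q - q\<^sup>-\<^sup>1)\<^sup>2\<close>, which is not a unit but
  not a zero divisor either.
  The inverse of \<open>K\<^sup>\<plusminus>\<^sub>0\<close> is \<open>q\<^bsup>-H\<^sub>0\<^esup>\<close>.
\<close>

locale SVir_expansion =
  fixes k :: complex and A :: sector
    and Kp Km T Gp Gm :: "'a::complex_topological_algebra fps series"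
    and H :: "int \<Rightarrow> 'a fps"
  assumes Kp_modes: "m \<notin> \<nat> \<Longrightarrow> Kp m = 0"
    and Km_modes: "- m \<notin> \<nat> \<Longrightarrow> Km m = 0"
    and T_modes: "m \<notin> \<int> \<Longrightarrow> T m = 0"
    and Gp_modes: "m \<notin> modes A \<Longrightarrow> Gp m = 0"
    and Gm_modes: "m \<notin> modes A \<Longrightarrow> Gm m = 0"

    \<comment> \<open>the series \<open>H\<close>\<close>
    and H_0_const: "i > 0 \<Longrightarrow> H 0 $ i = 0"
    and Kp_0: "Kp 0 = qpow_elem (H 0 $ 0)"
    and Km_0: "Km 0 = qpow_elem (H 0 $ 0)"
    and Kp_H: "exp_series (Abs_fps (\<lambda>m. if m = 0 then 0 else qdiff *\<^sub>h H (int m)))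
      = fps_const (qpow_elem (- (H 0 $ 0))) * Abs_fps (\<lambda>m. Kp (real m))"
    and Km_H: "exp_series (Abs_fps (\<lambda>m. if m = 0 then 0 else qdiff *\<^sub>h H (- int m)))
      = fps_const (qpow_elem (- (H 0 $ 0))) * Abs_fps (\<lambda>m. Km (- real m))"

    \<comment> \<open>the infinite sums occurring in the relations make sense\<close>
    and summable_K: "hsummable (K_term Kp Km) (K_index m)"
    and summable_KGpK: "hsummable (KXK_term Kp Km Gp m) UNIV"
    and summable_KGmK: "hsummable (KXK_term Kp Km Gm m) UNIV"
    and summable_N_GG: "hsummable (\<lambda>\<gamma>. N_GG Gp Gm (- \<gamma>) (m + \<gamma>)) (modes A)"
    and summable_KWK: "hsummable (KXK_term Kp Km (W_series k A Kp Km T Gp Gm) m) UNIV"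

    \<comment> \<open>the defining relations\<close>
    and Kp_Kp: "Kp m * Kp n = Kp n * Kp m"
    and Km_Km: "Km m * Km n = Km n * Km m"
    and Km_Kp: "Km m * Kp n = expand_zw (KK_factor k) Kp Km m n"
    and Km_T: "Km m * T n = expand_zw (KT_factor k) T Km m n"
    and T_Kp: "T m * Kp n = expand_zw (KT_factor k) Kp T m n"
    and Km_Gp: "Km m * Gp n = expand_zw (KG_factor (k+2)) Gp Km m n"
    and Km_Gm: "Km m * Gm n = expand_zw (KG_factor (-(k+2))) Gm Km m n"
    and Gp_Kp: "Gp m * Kp n = expand_zw (KG_factor (-(k+2))) Kp Gp m n"
    and Gm_Kp: "Gm m * Kp n = expand_zw (KG_factor (k+2)) Kp Gm m n"
    and Gp_Gp: "acomm Gp Gp m n = 0"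
    and Gm_Gm: "acomm Gm Gm m n = 0"
    and Gp_Gm: "(qdiff ^ 2) *\<^sub>h acomm Gp Gm m n =
          inverse (qint (k+1)) *\<^sub>h
            qdelta_at_w (qdelta (modes A) (4*(k+1))) (dil (2*(k+1)) (K_series Kp Km)) m n
        - qdelta_at_w (qdelta (modes A) (2*(k+2))) one_series m n
        + qdelta_at_w (qdelta (modes A) (2*(k+1))) (dil (k+1) T) m n"
    and Gp_T: "comm Gp T m n =
          (qdiff * qint (k+2) * inverse (qint (k+1))) *\<^sub>h
            qdelta_at_w (qdelta (modes A) (3*(k+1))) (dil (k+1) (KXK_series Kp Km Gp)) m n"
    and Gm_T: "comm Gm T m n =
        - ((qdiff * qint (k+2) * inverse (qint (k+1))) *\<^sub>h
            qdelta_at_w (qdelta (modes A) (-3*(k+1))) (dil (-(k+1)) (KXK_series Kp Km Gm)) m n)"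
    and T_T: "comm T T m n =
          (qdiff * qint (k+2) ^ 2 * inverse (qint (k+1))) *\<^sub>h
           (qdelta_at_w (qdelta \<int> (2*(k+1)))
              (dil (k+1) (KXK_series Kp Km (W_series k A Kp Km T Gp Gm))) m n
          - qdelta_at_w (qdelta \<int> (-2*(k+1)))
              (dil (-(k+1)) (KXK_series Kp Km (W_series k A Kp Km T Gp Gm))) m n)"


section \<open>The undeformed currents\<close>

definition sc_G :: "complex \<Rightarrow> 'a::complex_topological_algebra fps series \<Rightarrow> 'a series" where
  "sc_G k G m = csqrt (2 / (k+2)) *\<^sub>C (G m $ 0)"

definition sc_I :: "complex \<Rightarrow> 'a::complex_topological_algebra fps series \<Rightarrow> 'a fps series \<Rightarrow> 'a series" where
  "sc_I k Kp Km m = (1 / (2*(k+2))) *\<^sub>C (K_series Kp Km m $ 1)"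

definition sc_L :: "complex \<Rightarrow> 'a::complex_topological_algebra fps series \<Rightarrow> 'a fps series
    \<Rightarrow> 'a fps series \<Rightarrow> 'a series" where
  "sc_L k Kp Km T m =
       (1 / (4*(k+2))) *\<^sub>C (T m $ 2)
     + (1 / (4*(k+1)*(k+2))) *\<^sub>C (K_series Kp Km m $ 2)
     + (k*(2*k+1) / (24*(k+1)*(k+2))) *\<^sub>C one_series m"

definition N2_superconformal :: "sector \<Rightarrow> complex \<Rightarrow> 'a::complex_algebra_1 series \<Rightarrow> 'a series
    \<Rightarrow> 'a series \<Rightarrow> 'a series \<Rightarrow> bool" where
  "N2_superconformal A c Gp Gm I L \<longleftrightarrow>
    (\<forall>m n.
      acomm Gp Gp m n = 0 \<and>
      acomm Gm Gm m n = 0 \<and>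
      acomm Gp Gm m n =
          2 *\<^sub>C at_w (Ddelta (modes A) 0) L m n
        + (at_w (Ddelta (modes A) 1) I m n + at_z (Ddelta (modes A) 1) I m n)
        + (c/3) *\<^sub>C (at_w (Ddelta (modes A) 2) one_series m n
                   - (1/4) *\<^sub>C at_w (Ddelta (modes A) 0) one_series m n) \<and>
      comm L Gp m n = (1/2) *\<^sub>C at_w (Ddelta \<int> 1) Gp m n + at_z (Ddelta (modes A) 1) Gp m n \<and>
      comm L Gm m n = (1/2) *\<^sub>C at_w (Ddelta \<int> 1) Gm m n + at_z (Ddelta (modes A) 1) Gm m n \<and>
      comm I Gp m n = at_w (Ddelta \<int> 0) Gp m n \<and>
      comm I Gm m n = - at_w (Ddelta \<int> 0) Gm m n \<and>
      comm I I m n = (c/3) *\<^sub>C at_w (Ddelta \<int> 1) one_series m n \<and>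
      comm I L m n = at_w (Ddelta \<int> 1) I m n \<and>
      comm L L m n =
          at_z (Ddelta \<int> 1) L m n + at_w (Ddelta \<int> 1) L m n
        + (c/12) *\<^sub>C (at_w (Ddelta \<int> 3) one_series m n - at_w (Ddelta \<int> 1) one_series m n))"

end

theory Submission
  imports Defs
begin

text \<open>
  Besides \<open>{G\<^sup>\<plusminus>, G\<^sup>\<plusminus>} = 0\<close>, only two relations have to be read off from the deformed algebra. Since
  \<open>K\<^sup>\<plusminus>(z) = 1 + O(\<hbar>)\<close>, the order \<open>\<hbar>\<close> of the relations between \<open>K\<^sup>\<plusminus>\<close> and \<open>G\<^sup>\<plusminus>\<close> gives
  \<open>[I, G\<^sup>\<plusminus>]\<close>. The orders 0 and 1 of the relation between \<open>G\<^sup>+\<close> and \<open>G\<^sup>-\<close> determine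
  \<open>T\<^bsup>(0)\<^esup>\<close> and \<open>T\<^bsup>(1)\<^esup>\<close>, and its order 2 then gives \<open>{G\<^sup>+, G\<^sup>-}\<close>.

  The other relations follow from these by Jacobi identities, so that the relations involving
  the infinite sums \<open>K\<^sup>-GK\<^sup>+\<close> and \<open>K\<^sup>-WK\<^sup>+\<close> are never expanded. As \<open>(G\<^sup>+\<^sub>r)\<^sup>2 = 0\<close>, the element
  \<open>{G\<^sup>+\<^sub>r, G\<^sup>-\<^sub>s}\<close> commutes with \<open>G\<^sup>+\<^sub>r\<close>, which yields \<open>[L\<^bsub>r+s\<^esub>, G\<^sup>+\<^sub>r]\<close>, and similarly for
  \<open>G\<^sup>-\<close>. Commuting \<open>I\<^sub>m\<close> with \<open>{G\<^sup>+\<^sub>r, G\<^sup>-\<^sub>s}\<close>, where \<open>r + s = n\<close> is fixed and \<open>r\<close> varies,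
  yields \<open>[I\<^sub>m, I\<^sub>n]\<close> and \<open>[I\<^sub>m, L\<^sub>n]\<close>, and commuting \<open>L\<^sub>m\<close> with it yields \<open>[L\<^sub>m, L\<^sub>n]\<close>.
\<close>

section \<open>Scalars and modes\<close>

global_interpretation scaleC: module "scaleC :: complex \<Rightarrow> 'a::complex_algebra_1 \<Rightarrow> 'a"
  by unfold_locales (simp_all add: scaleC_add_right scaleC_add_left scaleC_scaleC scaleC_one)

lemma scaleC_cancel:
  fixes x y :: "'a::complex_algebra_1"
  assumes "c *\<^sub>C x = c *\<^sub>C y" "c \<noteq> 0"
  shows "x = y"
proof -
  have "(1/c) *\<^sub>C c *\<^sub>C x = (1/c) *\<^sub>C c *\<^sub>C y" using assms by simp
  with assms(2) show ?thesis by (simp add: scaleC_scaleC scaleC_one)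
qed

lemma Ddelta_mem [simp]: "m \<in> S \<Longrightarrow> Ddelta S j m = of_real m ^ j" "m \<notin> S \<Longrightarrow> Ddelta S j m = 0"
  by (simp_all add: Ddelta_def)

lemma one_series_commute: "one_series m * x = x * one_series m"
  by (simp add: one_series_def)

lemma scaleC_one_series: "(p = 0 \<Longrightarrow> a = b) \<Longrightarrow> a *\<^sub>C one_series p = b *\<^sub>C one_series p"
  by (simp add: one_series_def)

lemma modes_iff_diff_half: "m \<in> modes A \<longleftrightarrow> (case A of R \<Rightarrow> m \<in> \<int> | NS \<Rightarrow> m - 1/2 \<in> \<int>)"
  by (cases A) (auto simp: modes_def image_iff intro!: bexI[of _ "m - 1/2"])

lemma modes_nonempty: "\<exists>r. r \<in> modes A"
  by (cases A) (auto simp: modes_def)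

lemma modes_minus_iff: "- m \<in> modes A \<longleftrightarrow> m \<in> modes A"
proof -
  have *: "- m - 1/2 \<in> \<int>" if "m - 1/2 \<in> \<int>" for m :: real
    using Ints_minus[OF Ints_add[OF that Ints_1]] by (simp add: algebra_simps)
  show ?thesis
    using *[of m] *[of "-m"] by (cases A) (auto simp: modes_iff_diff_half)
qed

lemma modes_add_Ints_iff:
  assumes "m \<in> \<int>"
  shows "m + r \<in> modes A \<longleftrightarrow> r \<in> modes A"
proof -
  have "m + x \<in> \<int> \<longleftrightarrow> x \<in> \<int>" for x
    using assms by (metis Ints_add Ints_diff add_diff_cancel_left')
  from this[of r] this[of "r - 1/2"] show ?thesis
    by (cases A) (auto simp: modes_iff_diff_half algebra_simps)
qed

lemma modes_add_modes_iff:
  assumes "m \<in> modes A"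
  shows "m + n \<in> \<int> \<longleftrightarrow> n \<in> modes A"
proof
  assume "m + n \<in> \<int>"
  from modes_add_Ints_iff[OF this, of "- n"] show "n \<in> modes A"
    using assms by (simp add: modes_minus_iff)
next
  assume "n \<in> modes A"
  with assms show "m + n \<in> \<int>"
  proof (cases A)
    case NS
    with assms \<open>n \<in> modes A\<close> have "(m - 1/2) + (n - 1/2) + 1 \<in> \<int>"
      by (intro Ints_add) (auto simp: modes_iff_diff_half)
    then show ?thesis by simp
  qed (auto simp: modes_def)
qed

section \<open>Reduction to the relations of the supercurrents\<close>

lemma N2_superconformal_from_G:
  fixes Gp Gm I L :: "'a::complex_algebra_1 series"
  assumes Gp_modes: "\<And>m. m \<notin> modes A \<Longrightarrow> Gp m = 0"
    and Gm_modes: "\<And>m. m \<notin> modes A \<Longrightarrow> Gm m = 0"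
    and I_modes: "\<And>m. m \<notin> \<int> \<Longrightarrow> I m = 0"
    and L_modes: "\<And>m. m \<notin> \<int> \<Longrightarrow> L m = 0"
    and Gp_Gp: "\<And>m n. Gp m * Gp n + Gp n * Gp m = 0"
    and Gm_Gm: "\<And>m n. Gm m * Gm n + Gm n * Gm m = 0"
    and Gp_Gm: "\<And>m n. m \<in> modes A \<Longrightarrow> n \<in> modes A \<Longrightarrow>
        Gp m * Gm n + Gm n * Gp m = 2 *\<^sub>C L (m + n) + of_real (m - n) *\<^sub>C I (m + n)
          + (c * (of_real m ^ 2 - 1/4)) *\<^sub>C one_series (m + n)"
    and I_Gp: "\<And>m n. m \<in> \<int> \<Longrightarrow> I m * Gp n - Gp n * I m = Gp (m + n)"
    and I_Gm: "\<And>m n. m \<in> \<int> \<Longrightarrow> I m * Gm n - Gm n * I m = - Gm (m + n)"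
  shows "N2_superconformal A (3 * c) Gp Gm I L"
proof -
  note distribs = scaleC.scale_right_distrib scaleC.scale_left_distrib scaleC.scale_right_diff_distrib
    scaleC.scale_left_diff_distrib
  note mult_scaleC = mult_scaleC_left mult_scaleC_right
  have square_0: "x * x = 0" if "x * x + x * x = 0" for x :: 'a
  proof (rule scaleC_cancel)
    show "2 *\<^sub>C (x * x) = 2 *\<^sub>C 0"
      using that scaleC_add_left[of 1 1 "x * x"] by (simp add: scaleC_one)
  qed simp
  have mid: "s = m - r \<Longrightarrow> m \<in> \<int> \<Longrightarrow> r \<in> modes A \<Longrightarrow> s \<in> modes A" for m r s
    using modes_add_Ints_iff[of m "- r" A] by (simp add: modes_minus_iff)

  have L_Gp: "L m * Gp r - Gp r * L m = of_real (m/2 - r) *\<^sub>C Gp (m + r)"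
    if m: "m \<in> \<int>" and r: "r \<in> modes A" for m r
  proof (rule scaleC_cancel[of 2])
    define s where "s = m - r"
    have s: "s \<in> modes A" and rs: "r + s = m" and rs': "r - s = 2 * r - m"
      using mid m r by (auto simp: s_def)
    have sq: "Gp r * Gp r = 0" using square_0 Gp_Gp by blast
    let ?X = "Gp r * Gm s + Gm s * Gp r"
    have "0 = ?X * Gp r - Gp r * ?X"
      using sq by (simp add: algebra_simps flip: mult.assoc) (simp add: sq mult.assoc)
    also have "\<dots> = 2 *\<^sub>C (L m * Gp r - Gp r * L m) + of_real (2 * r - m) *\<^sub>C (I m * Gp r - Gp r * I m)"
      unfolding Gp_Gm[OF r s] rs rs'
      by (simp add: distrib_left distrib_right mult_scaleC one_series_commute[of _ "Gp r"] scaleC.scale_right_diff_distrib)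
    finally have "2 *\<^sub>C (L m * Gp r - Gp r * L m) = - (of_real (2 * r - m) *\<^sub>C Gp (m + r))"
      unfolding I_Gp[OF m] by (simp add: eq_neg_iff_add_eq_0)
    also have "\<dots> = 2 *\<^sub>C of_real (m/2 - r) *\<^sub>C Gp (m + r)"
      by (simp add: scaleC_scaleC algebra_simps flip: scaleC.scale_minus_left)
    finally show "2 *\<^sub>C (L m * Gp r - Gp r * L m) = 2 *\<^sub>C of_real (m/2 - r) *\<^sub>C Gp (m + r)" .
  qed simp
  have L_Gm: "L m * Gm s - Gm s * L m = of_real (m/2 - s) *\<^sub>C Gm (m + s)"
    if m: "m \<in> \<int>" and s: "s \<in> modes A" for m s
  proof (rule scaleC_cancel[of 2])
    define r where "r = m - s"
    have r: "r \<in> modes A" and rs: "r + s = m" and rs': "r - s = m - 2 * s"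
      using mid m s by (auto simp: r_def)
    have sq: "Gm s * Gm s = 0" using square_0 Gm_Gm by blast
    let ?X = "Gp r * Gm s + Gm s * Gp r"
    have "0 = ?X * Gm s - Gm s * ?X"
      using sq by (simp add: algebra_simps flip: mult.assoc) (simp add: sq mult.assoc)
    also have "\<dots> = 2 *\<^sub>C (L m * Gm s - Gm s * L m) + of_real (m - 2 * s) *\<^sub>C (I m * Gm s - Gm s * I m)"
      unfolding Gp_Gm[OF r s] rs rs'
      by (simp add: distrib_left distrib_right mult_scaleC one_series_commute[of _ "Gm s"] scaleC.scale_right_diff_distrib)
    finally have "2 *\<^sub>C (L m * Gm s - Gm s * L m) = of_real (m - 2 * s) *\<^sub>C Gm (m + s)"
      unfolding I_Gm[OF m] by (simp add: eq_neg_iff_add_eq_0)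
    also have "\<dots> = 2 *\<^sub>C of_real (m/2 - s) *\<^sub>C Gm (m + s)"
      by (simp add: scaleC_scaleC algebra_simps)
    finally show "2 *\<^sub>C (L m * Gm s - Gm s * L m) = 2 *\<^sub>C of_real (m/2 - s) *\<^sub>C Gm (m + s)" .
  qed simp

  have derivation: "X * (Y * Z + Z * Y) - (Y * Z + Z * Y) * X
      = ((X * Y - Y * X) * Z + Z * (X * Y - Y * X)) + (Y * (X * Z - Z * X) + (X * Z - Z * X) * Y)"
    for X Y Z :: 'a
    by (simp add: algebra_simps)
  have expand: "X * (2 *\<^sub>C Y + a *\<^sub>C Z + b *\<^sub>C one_series p) - (2 *\<^sub>C Y + a *\<^sub>C Z + b *\<^sub>C one_series p) * X
      = 2 *\<^sub>C (X * Y - Y * X) + a *\<^sub>C (X * Z - Z * X)" for X Y Z :: 'a and a b p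
    by (simp add: distrib_left distrib_right mult_scaleC one_series_commute[of _ X] scaleC.scale_right_diff_distrib)

  have collect: "a *\<^sub>C (x1 *\<^sub>C x + y1 *\<^sub>C y + z1 *\<^sub>C z) + b *\<^sub>C (x2 *\<^sub>C x + y2 *\<^sub>C y + z2 *\<^sub>C z)
      = (a * x1 + b * x2) *\<^sub>C x + (a * y1 + b * y2) *\<^sub>C y + (a * z1 + b * z2) *\<^sub>C z"
    for x y z :: 'a and a b x1 y1 z1 x2 y2 z2
    by (simp add: scaleC_scaleC distribs ac_simps)

  have I_GG: "2 *\<^sub>C (I m * L n - L n * I m) + of_real (2 * r - n) *\<^sub>C (I m * I n - I n * I m)
      = of_real (2 * m) *\<^sub>C I (m + n) + (c * of_real (m\<^sup>2 + 2 * m * r)) *\<^sub>C one_series (m + n)"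
    if m: "m \<in> \<int>" and n: "n \<in> \<int>" and r: "r \<in> modes A" for m n r
  proof -
    define s where "s = n - r"
    have s: "s \<in> modes A" and rs: "r + s = n" and rs': "r - s = 2 * r - n"
      using mid n r by (auto simp: s_def)
    have mr: "m + r \<in> modes A" and ms: "m + s \<in> modes A"
      using m r s by (simp_all add: modes_add_Ints_iff)
    have sums: "m + r + s = m + n" "r + (m + s) = m + n" using rs by auto
    have diffs: "m + r - s = m + 2 * r - n" "r - (m + s) = 2 * r - m - n" by (simp_all add: s_def)
    let ?X = "Gp r * Gm s + Gm s * Gp r"
    have "2 *\<^sub>C (I m * L n - L n * I m) + of_real (2 * r - n) *\<^sub>C (I m * I n - I n * I m)
      = I m * ?X - ?X * I m"
      unfolding Gp_Gm[OF r s] rs rs' by (rule expand[symmetric])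
    also have "\<dots> = (Gp (m + r) * Gm s + Gm s * Gp (m + r)) - (Gp r * Gm (m + s) + Gm (m + s) * Gp r)"
      unfolding derivation I_Gp[OF m] I_Gm[OF m] by simp
    also have "\<dots> = of_real (2 * m) *\<^sub>C I (m + n) + (c * of_real (m\<^sup>2 + 2 * m * r)) *\<^sub>C one_series (m + n)"
      unfolding Gp_Gm[OF mr s] Gp_Gm[OF r ms] sums diffs
      by (simp add: distribs algebra_simps power2_eq_square)
        (simp add: mult_2_right flip: scaleC_add_left)
    finally show ?thesis .
  qed
  have I_I: "I m * I n - I n * I m = (c * of_real m) *\<^sub>C one_series (m + n)"
    if m: "m \<in> \<int>" and n: "n \<in> \<int>" for m n
  proof -
    obtain r where r: "r \<in> modes A" using modes_nonempty by blast
    then have r1: "r + 1 \<in> modes A"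
      using modes_add_Ints_iff[of 1 r A] by (simp add: add.commute)
    show ?thesis
    proof (rule scaleC_cancel[of 2])
      let ?C = "I m * I n - I n * I m"
      have "2 *\<^sub>C ?C = (2 *\<^sub>C (I m * L n - L n * I m) + of_real (2 * (r + 1) - n) *\<^sub>C ?C)
            - (2 *\<^sub>C (I m * L n - L n * I m) + of_real (2 * r - n) *\<^sub>C ?C)"
        by (simp add: scaleC_scaleC flip: scaleC.scale_left_diff_distrib)
      also have "\<dots> = 2 *\<^sub>C (c * of_real m) *\<^sub>C one_series (m + n)"
        unfolding I_GG[OF m n r] I_GG[OF m n r1]
        by (simp add: scaleC_scaleC algebra_simps flip: scaleC.scale_left_diff_distrib)
      finally show "2 *\<^sub>C ?C = 2 *\<^sub>C (c * of_real m) *\<^sub>C one_series (m + n)" .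
    qed simp
  qed
  have I_L: "I m * L n - L n * I m = of_real m *\<^sub>C I (m + n)"
    if m: "m \<in> \<int>" and n: "n \<in> \<int>" for m n
  proof -
    obtain r where r: "r \<in> modes A" using modes_nonempty by blast
    have *: "(c * of_real (m\<^sup>2 + 2 * m * r)) *\<^sub>C (one_series (m + n) :: 'a)
      = of_real (2 * r - n) *\<^sub>C (c * of_real m) *\<^sub>C one_series (m + n)"
      unfolding scaleC_scaleC
      by (rule scaleC_one_series) (simp add: add_eq_0_iff power2_eq_square algebra_simps)
    show ?thesis
    proof (rule scaleC_cancel[of 2])
      show "2 *\<^sub>C (I m * L n - L n * I m) = 2 *\<^sub>C of_real m *\<^sub>C I (m + n)"
        using I_GG[OF m n r] unfolding * I_I[OF m n] by (simp add: scaleC_scaleC)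
    qed simp
  qed
  have L_L: "L m * L n - L n * L m = of_real (m - n) *\<^sub>C L (m + n)
      + (c / 4 * of_real (m^3 - m)) *\<^sub>C one_series (m + n)"
    if m: "m \<in> \<int>" and n: "n \<in> \<int>" for m n
  proof -
    obtain r where r: "r \<in> modes A" using modes_nonempty by blast
    define s where "s = n - r"
    have s: "s \<in> modes A" and rs: "r + s = n" and rs': "r - s = 2 * r - n"
      using mid n r by (auto simp: s_def)
    have mr: "m + r \<in> modes A" and ms: "m + s \<in> modes A"
      using m r s by (simp_all add: modes_add_Ints_iff)
    have sums: "m + r + s = m + n" "r + (m + s) = m + n" using rs by auto
    have diffs: "m + r - s = m + 2 * r - n" "r - (m + s) = 2 * r - m - n" by (simp_all add: s_def)
    have s_eq: "s = n - r" by (simp add: s_def)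
    let ?X = "Gp r * Gm s + Gm s * Gp r"
    have L_I: "L m * I n - I n * L m = - (of_real n *\<^sub>C I (m + n))"
      using I_L[OF n m] by (simp add: algebra_simps)
    have "2 *\<^sub>C (L m * L n - L n * L m) + of_real (2 * r - n) *\<^sub>C (L m * I n - I n * L m)
      = L m * ?X - ?X * L m"
      unfolding Gp_Gm[OF r s] rs rs' by (rule expand[symmetric])
    also have "\<dots> = of_real (m/2 - r) *\<^sub>C (Gp (m + r) * Gm s + Gm s * Gp (m + r))
        + of_real (m/2 - s) *\<^sub>C (Gp r * Gm (m + s) + Gm (m + s) * Gp r)"
      unfolding derivation L_Gp[OF m r] L_Gm[OF m s]
      by (simp only: mult_scaleC scaleC.scale_right_distrib add.assoc)
    also have "\<dots> = of_real (m/2 - r) *\<^sub>C (2 *\<^sub>C L (m + n) + of_real (m + 2 * r - n) *\<^sub>C I (m + n)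
          + (c * (of_real (m + r) ^ 2 - 1/4)) *\<^sub>C one_series (m + n))
        + of_real (m/2 - s) *\<^sub>C (2 *\<^sub>C L (m + n) + of_real (2 * r - m - n) *\<^sub>C I (m + n)
          + (c * (of_real r ^ 2 - 1/4)) *\<^sub>C one_series (m + n))"
      unfolding Gp_Gm[OF mr s] Gp_Gm[OF r ms] sums diffs by (rule refl)
    also have "\<dots> = (2 * of_real (m - n)) *\<^sub>C L (m + n) + (- of_real n * of_real (2 * r - n)) *\<^sub>C I (m + n)
        + (c * (of_real (m/2 - r) * (of_real (m + r) ^ 2 - 1/4) + of_real (m/2 - s) * (of_real r ^ 2 - 1/4)))
            *\<^sub>C one_series (m + n)"
      unfolding collect
      by (intro arg_cong2[where f="(+)"] arg_cong2[where f="(*\<^sub>C)"] refl)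
        (simp_all add: s_eq field_simps)
    also have "(c * (of_real (m/2 - r) * (of_real (m + r) ^ 2 - 1/4) + of_real (m/2 - s) * (of_real r ^ 2 - 1/4)))
            *\<^sub>C (one_series (m + n) :: 'a)
        = (2 * (c / 4 * of_real (m^3 - m))) *\<^sub>C one_series (m + n)"
      by (rule scaleC_one_series)
         (simp add: s_eq add_eq_0_iff power2_eq_square power3_eq_cube algebra_simps add_divide_distrib)
    finally have *: "2 *\<^sub>C (L m * L n - L n * L m) = 2 *\<^sub>C (of_real (m - n) *\<^sub>C L (m + n)
      + (c / 4 * of_real (m^3 - m)) *\<^sub>C one_series (m + n))"
      unfolding L_I by (simp add: scaleC_scaleC distribs algebra_simps)
    show ?thesis by (rule scaleC_cancel[OF *]) simp
  qed

  have not_modes: "m + n \<notin> modes A" if "m \<notin> \<int>" "n \<in> modes A" for m n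
    using that modes_add_modes_iff[of "m + n" A "- n"] by (auto simp: modes_minus_iff)
  have not_Ints: "m + n \<notin> \<int>" if "m \<in> \<int>" "n \<notin> \<int>" for m n :: real
    using that by (metis Ints_diff add_diff_cancel_left')
  have not_Ints': "n + m \<notin> \<int>" if "m \<in> \<int>" "n \<notin> \<int>" for m n :: real
    using not_Ints[OF that] by (simp add: add.commute)
  have one_0: "p \<notin> \<int> \<Longrightarrow> one_series p = 0" for p
    by (auto simp: one_series_def)
  have uminus_Ints: "- m \<in> \<int> \<longleftrightarrow> m \<in> \<int>" for m :: real
    using Ints_minus[of m] Ints_minus[of "- m"] by auto
  note at_defs = comm_def acomm_def at_w_def at_z_def modes_minus_iff uminus_Ints
  show ?thesis
    unfolding N2_superconformal_def
  proof (intro allI conjI)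
    fix m n
    show "acomm Gp Gp m n = 0" "acomm Gm Gm m n = 0"
      using Gp_Gp Gm_Gm by (simp_all add: acomm_def)
    show "acomm Gp Gm m n =
          2 *\<^sub>C at_w (Ddelta (modes A) 0) L m n
        + (at_w (Ddelta (modes A) 1) I m n + at_z (Ddelta (modes A) 1) I m n)
        + (3 * c / 3) *\<^sub>C (at_w (Ddelta (modes A) 2) one_series m n
                   - (1/4) *\<^sub>C at_w (Ddelta (modes A) 0) one_series m n)"
    proof (cases "m \<in> modes A \<longleftrightarrow> n \<in> modes A")
      case True
      show ?thesis
      proof (cases "m \<in> modes A")
        case m: True
        with True have "acomm Gp Gm m n = 2 *\<^sub>C L (m + n) + of_real (m - n) *\<^sub>C I (m + n)
          + (c * (of_real m ^ 2 - 1/4)) *\<^sub>C one_series (m + n)"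
          unfolding acomm_def by (intro Gp_Gm) auto
        with True m show ?thesis
          by (simp add: at_w_def at_z_def modes_minus_iff distribs scaleC_scaleC scaleC_one algebra_simps)
      qed (use True in \<open>simp add: at_defs Gp_modes Gm_modes\<close>)
    next
      case False
      then have "m + n \<notin> \<int>"
        using modes_add_modes_iff[of m A n] modes_add_modes_iff[of n A m] by (auto simp: add.commute)
      with False show ?thesis
        by (auto simp: at_defs Gp_modes Gm_modes L_modes I_modes one_0)
    qed
    show "comm L Gp m n = (1/2) *\<^sub>C at_w (Ddelta \<int> 1) Gp m n + at_z (Ddelta (modes A) 1) Gp m n"
      by (cases "m \<in> \<int>"; cases "n \<in> modes A")
        (simp_all add: at_defs L_Gp L_modes Gp_modes not_modes modes_add_Ints_iff scaleC_scaleC distribs)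
    show "comm L Gm m n = (1/2) *\<^sub>C at_w (Ddelta \<int> 1) Gm m n + at_z (Ddelta (modes A) 1) Gm m n"
      by (cases "m \<in> \<int>"; cases "n \<in> modes A")
        (simp_all add: at_defs L_Gm L_modes Gm_modes not_modes modes_add_Ints_iff scaleC_scaleC distribs)
    show "comm I Gp m n = at_w (Ddelta \<int> 0) Gp m n"
      by (cases "m \<in> \<int>") (simp_all add: at_defs I_Gp I_modes scaleC_one)
    show "comm I Gm m n = - at_w (Ddelta \<int> 0) Gm m n"
      by (cases "m \<in> \<int>") (simp_all add: at_defs I_Gm I_modes scaleC_one)
    show "comm I I m n = (3 * c / 3) *\<^sub>C at_w (Ddelta \<int> 1) one_series m n"
      by (cases "m \<in> \<int>"; cases "n \<in> \<int>")
        (simp_all add: at_defs I_I I_modes one_0 not_Ints not_Ints' scaleC_scaleC)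
    show "comm I L m n = at_w (Ddelta \<int> 1) I m n"
      by (cases "m \<in> \<int>"; cases "n \<in> \<int>")
        (simp_all add: at_defs I_L I_modes L_modes not_Ints not_Ints')
    show "comm L L m n =
          at_z (Ddelta \<int> 1) L m n + at_w (Ddelta \<int> 1) L m n
        + (3 * c / 12) *\<^sub>C (at_w (Ddelta \<int> 3) one_series m n - at_w (Ddelta \<int> 1) one_series m n)"
      by (cases "m \<in> \<int>"; cases "n \<in> \<int>")
        (simp_all add: at_defs L_L L_modes one_0 not_Ints not_Ints' scaleC_scaleC distribs algebra_simps)
  qed
qed

section \<open>Expansions in the deformation parameter\<close>

lemma hscale_nth: "(c *\<^sub>h x) $ i = (\<Sum>j=0..i. (c $ j) *\<^sub>C (x $ (i - j)))"
  by (simp add: hscale_def fps_mult_nth mult_scaleC_left)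

lemma sum_upto_2: "(\<Sum>j=0..(2::nat). f j) = f 0 + f 1 + f 2"
  by (simp add: numeral_2_eq_2)

lemma hscale_nth_0 [simp]: "(c *\<^sub>h x) $ 0 = (c $ 0) *\<^sub>C (x $ 0)"
  and hscale_nth_1 [simp]: "(c *\<^sub>h x) $ Suc 0 = (c $ 0) *\<^sub>C (x $ Suc 0) + (c $ Suc 0) *\<^sub>C (x $ 0)"
  and hscale_nth_2 [simp]: "(c *\<^sub>h x) $ 2 = (c $ 0) *\<^sub>C (x $ 2) + (c $ Suc 0) *\<^sub>C (x $ Suc 0) + (c $ 2) *\<^sub>C (x $ 0)"
  by (simp_all add: hscale_nth sum_upto_2)

lemma hscale_0_right [simp]: "c *\<^sub>h 0 = 0"
  by (simp add: hscale_def)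

lemma hscale_hscale: "c *\<^sub>h d *\<^sub>h x = (c * d) *\<^sub>h x"
proof -
  have "Abs_fps (\<lambda>i. (c $ i) *\<^sub>C 1) * Abs_fps (\<lambda>i. (d $ i) *\<^sub>C 1) = Abs_fps (\<lambda>i. ((c * d) $ i) *\<^sub>C (1::'a))"
    by (rule fps_ext) (simp add: fps_mult_nth scaleC.scale_sum_left mult_scaleC_left mult_scaleC_right scaleC_scaleC mult.commute)
  then show ?thesis
    by (simp add: hscale_def flip: mult.assoc)
qed

lemma fps_mult_nth_2: "(f * g) $ 2 = f $ 0 * g $ 2 + f $ 1 * g $ 1 + f $ 2 * g $ 0"
  by (simp add: fps_mult_nth sum_upto_2)

lemma fps_mult_nth_3: "(f * g) $ 3 = f $ 0 * g $ 3 + f $ 1 * g $ 2 + f $ 2 * g $ 1 + f $ 3 * g $ 0"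
  by (simp add: fps_mult_nth eval_nat_numeral)

lemma qpow_nth [simp]: "qpow u $ i = u ^ i / fact i"
  by (simp add: qpow_def)

lemma qpow_mult: "qpow a * qpow b = qpow (a + b)"
  by (simp add: qpow_def fps_exp_add_mult)

lemma qdiff_nth: "qdiff $ 0 = 0" "qdiff $ Suc 0 = 2" "qdiff $ 2 = 0" "qdiff $ 3 = 1/3"
  by (simp_all add: qdiff_def fact_numeral)

lemma qint_mult_qdiff: "qint u * qdiff = qpow u - qpow (- u)"
proof (cases "u = 0")
  case False
  have "qdiff \<noteq> 0" using qdiff_nth(2) by (metis fps_zero_nth zero_neq_numeral)
  moreover have "subdegree qdiff = 1"
    by (rule subdegreeI) (simp_all add: qdiff_nth)
  moreover have "subdegree (qpow u - qpow (- u)) = 1"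
    by (rule subdegreeI) (simp_all add: False)
  moreover have "qpow u - qpow (- u) \<noteq> 0"
    using False by (auto simp: fps_eq_iff intro!: exI[of _ 1])
  ultimately show ?thesis
    unfolding qint_def by (intro dvd_div_mult_self) (auto simp: fps_dvd_iff)
qed (simp add: qint_def)

lemma qint_nth: "qint u $ 0 = u" "qint u $ Suc 0 = 0" "qint u $ 2 = u * (u\<^sup>2 - 1) / 6"
proof -
  have *: "(qint u * qdiff) $ i = (qpow u - qpow (- u)) $ i" for i by (simp add: qint_mult_qdiff)
  show 0: "qint u $ 0 = u" using *[of 1] by (simp add: fps_mult_nth qdiff_nth)
  show 1: "qint u $ Suc 0 = 0" using *[of 2] by (simp add: fps_mult_nth_2 qdiff_nth)
  show "qint u $ 2 = u * (u\<^sup>2 - 1) / 6"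
  proof -
    have "qint u $ 2 = (6 * qint u $ 2 + u) / 6 - u / 6" by (simp add: add_divide_distrib)
    also have "6 * qint u $ 2 + u = u ^ 3"
      using *[of 3] by (simp add: fps_mult_nth_3 qdiff_nth 0 1 fact_numeral add.commute)
    finally show ?thesis by (simp add: power2_eq_square power3_eq_cube algebra_simps diff_divide_distrib)
  qed
qed

lemma inverse_qint_nth:
  assumes "u \<noteq> 0"
  shows "inverse (qint u) $ 0 = 1 / u" "inverse (qint u) $ Suc 0 = 0"
    "inverse (qint u) $ 2 = - ((u\<^sup>2 - 1) / (6 * u))"
proof -
  have *: "(inverse (qint u) * qint u) $ i = (1 :: complex fps) $ i" for i
    using assms by (simp add: inverse_mult_eq_1 qint_nth)
  show 0: "inverse (qint u) $ 0 = 1 / u" by (simp add: qint_nth field_simps)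
  show 1: "inverse (qint u) $ Suc 0 = 0" using *[of 1] assms by (simp add: fps_mult_nth 0 qint_nth)
  have "inverse (qint u) $ 2 * u = - ((u\<^sup>2 - 1) / 6)"
    using *[of 2] assms
    by (simp add: fps_mult_nth_2 0 1 qint_nth eq_neg_iff_add_eq_0 add.commute del: fps_inverse_nth_0)
  then show "inverse (qint u) $ 2 = - ((u\<^sup>2 - 1) / (6 * u))"
    using nonzero_eq_divide_eq[OF assms, of "inverse (qint u) $ 2" "- ((u\<^sup>2 - 1) / 6)"] by simp
qed

lemma inverse_lin: "inverse (lin a) * lin a = 1"
proof -
  have "fps_right_inverse (lin a) (inverse (lin a $ 0)) * lin a = 1"
    by (rule fps_left_inverse'[of 1]) (simp_all add: lin_def)
  then show ?thesis by (simp add: fps_inverse_def[of "lin a"])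
qed

lemma mult_lin_nth: "(f * lin a) $ i = f $ i - (if i = 0 then 0 else qpow a * f $ (i - 1))"
proof -
  have "f * lin a = f - fps_const (qpow a) * (f * fps_X)"
    by (simp add: lin_def algebra_simps)
  then show ?thesis by simp
qed

lemma KG_factor_mult_lin: "KG_factor u * lin (2 * u) = fps_const (qpow u) * (1 - fps_X)"
  by (simp add: KG_factor_def mult.assoc inverse_lin)

lemma KG_factor_rec:
  "KG_factor u $ 0 = qpow u"
  "KG_factor u $ Suc j = qpow (2 * u) * KG_factor u $ j - (if j = 0 then qpow u else 0)"
proof -
  have *: "KG_factor u $ i - (if i = 0 then 0 else qpow (2 * u) * KG_factor u $ (i - 1)) =
    qpow u * ((if i = 0 then 1 else 0) - (if i = 1 then 1 else 0))" for i
    unfolding mult_lin_nth[symmetric] KG_factor_mult_lin by simp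
  show "KG_factor u $ 0 = qpow u" using *[of 0] by simp
  show "KG_factor u $ Suc j = qpow (2 * u) * KG_factor u $ j - (if j = 0 then qpow u else 0)"
    using *[of "Suc j"] by (simp add: algebra_simps split: if_splits)
qed

lemma KG_factor_nth:
  "KG_factor u $ j $ 0 = (if j = 0 then 1 else 0)"
  "KG_factor u $ j $ Suc 0 = (if j = 0 then u else 2 * u)"
proof -
  have "KG_factor u $ j $ 0 = (if j = 0 then 1 else 0) \<and> KG_factor u $ j $ Suc 0 = (if j = 0 then u else 2 * u)"
    by (induction j) (auto simp: KG_factor_rec fps_mult_nth)
  then show "KG_factor u $ j $ 0 = (if j = 0 then 1 else 0)"
    "KG_factor u $ j $ Suc 0 = (if j = 0 then u else 2 * u)" by auto
qed

lemma exp_series_nth_nth_0: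
  fixes X :: "'a::complex_algebra_1 fps fps"
  assumes X: "\<And>m. X $ m $ 0 = 0" and m: "m > 0"
  shows "exp_series X $ m $ 0 = 0"
proof -
  have "(X ^ n) $ m $ 0 = 0" for n
  proof (cases n)
    case (Suc l)
    show ?thesis
      by (simp add: Suc fps_mult_nth fps_sum_nth X)
  qed (use m in simp)
  then show ?thesis
    by (simp add: exp_series_def fps_sum_nth)
qed

lemma qpow_elem_nth_0 [simp]: "qpow_elem x $ 0 = 1"
  by (simp add: qpow_elem_def)

lemma exp_series_nth_0_imp:
  fixes Y :: "nat \<Rightarrow> 'a::complex_algebra_1 fps"
  assumes "exp_series (Abs_fps (\<lambda>m. if m = 0 then 0 else qdiff *\<^sub>h h m))
      = fps_const (qpow_elem x) * Abs_fps Y" and "m > 0"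
  shows "Y m $ 0 = 0"
proof -
  have "exp_series (Abs_fps (\<lambda>m. if m = 0 then 0 else qdiff *\<^sub>h h m)) $ m $ 0 = 0"
    using assms(2) by (intro exp_series_nth_nth_0) (simp_all add: qdiff_nth)
  then show ?thesis
    unfolding assms(1) by simp
qed

lemma expand_zw_nth_1:
  assumes fin: "finite {j. Y (n - real j) * X (m + real j) \<noteq> 0}"
    and f0: "\<And>j. f $ j $ 0 = (if j = 0 then 1 else 0)"
    and J: "finite J" "\<And>j. j \<notin> J \<Longrightarrow> Y (n - real j) $ 0 * X (m + real j) $ 0 = 0"
  shows "expand_zw f Y X m n $ Suc 0 = (Y n * X m) $ Suc 0
    + (\<Sum>j\<in>J. (f $ j $ Suc 0) *\<^sub>C (Y (n - real j) $ 0 * X (m + real j) $ 0))"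
proof -
  let ?P = "\<lambda>j. Y (n - real j) * X (m + real j)"
  let ?S = "insert 0 ({j. ?P j \<noteq> 0} \<union> J)"
  have fin': "finite ?S" using fin J by auto
  have "expand_zw f Y X m n = (\<Sum>j\<in>?S. (f $ j) *\<^sub>h ?P j)"
    unfolding expand_zw_def using fin' by (intro sum.mono_neutral_left) auto
  then have "expand_zw f Y X m n $ Suc 0 = (\<Sum>j\<in>?S. ((f $ j) *\<^sub>h ?P j) $ Suc 0)"
    by (simp only: fps_sum_nth)
  also have "\<dots> = (\<Sum>j\<in>?S. (if j = 0 then ?P j $ Suc 0 else 0)) + (\<Sum>j\<in>?S. (f $ j $ Suc 0) *\<^sub>C (?P j $ 0))"
    unfolding sum.distrib[symmetric] by (intro sum.cong refl) (simp add: f0 scaleC_one)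
  also have "(\<Sum>j\<in>?S. (if j = 0 then ?P j $ Suc 0 else 0)) = (Y n * X m) $ Suc 0"
    using fin' by (subst sum.delta) auto
  also have "(\<Sum>j\<in>?S. (f $ j $ Suc 0) *\<^sub>C (?P j $ 0)) = (\<Sum>j\<in>J. (f $ j $ Suc 0) *\<^sub>C (?P j $ 0))"
    using fin' J(2) by (intro sum.mono_neutral_right) auto
  finally show ?thesis by simp
qed

section \<open>Leading orders of the deformed relations\<close>

lemma one_series_nth: "one_series m $ i = (if i = 0 then one_series m else 0)"
  by (simp add: one_series_def)

context SVir_expansion
begin

lemma Kp_nth_0: "Kp m $ 0 = one_series m"
proof (cases "m \<in> \<nat>")
  case True
  then obtain j where j: "m = real j" by (elim Nats_cases)
  show ?thesis
  proof (cases "j = 0")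
    case False
    then show ?thesis
      using exp_series_nth_0_imp[OF Kp_H, of j] by (simp add: j one_series_def)
  qed (simp add: j Kp_0 one_series_def)
qed (auto simp: Kp_modes one_series_def)

lemma Km_nth_0: "Km m $ 0 = one_series m"
proof (cases "- m \<in> \<nat>")
  case True
  then obtain j where "- m = real j" by (elim Nats_cases)
  then have j: "m = - real j" by simp
  show ?thesis
  proof (cases "j = 0")
    case False
    then show ?thesis
      using exp_series_nth_0_imp[OF Km_H, of j] by (simp add: j one_series_def)
  qed (simp add: j Km_0 one_series_def)
qed (auto simp: Km_modes one_series_def)

lemma K_series_not_Ints:
  assumes "m \<notin> \<int>"
  shows "K_series Kp Km m = 0"
proof -
  have "m \<noteq> of_int (int \<nu> - int \<mu>)" for \<mu> \<nu>
    using assms Ints_of_int by metis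
  then have "K_index m = {}"
    by (fastforce simp: K_index_def algebra_simps)
  then show ?thesis
    by (simp add: K_series_def hsum_def fps_eq_iff)
qed

lemma K_index_of_int: "K_index (of_int i) = {(\<mu>, \<nu>). i + int \<mu> = int \<nu>}"
proof -
  have "of_int i + real \<mu> - real \<nu> = of_int (i + int \<mu> - int \<nu>)" for \<mu> \<nu> by simp
  then show ?thesis
    unfolding K_index_def by (simp only: of_int_eq_0_iff) auto
qed

lemma K_series_nth_0: "K_series Kp Km m $ 0 = one_series m"
proof -
  have "K_series Kp Km m $ 0 = infsum (\<lambda>x. K_term Kp Km x $ 0) (if m = 0 then {(0, 0)} else {})"
    unfolding K_series_def hsum_def fps_nth_Abs_fps
    by (intro infsum_cong_neutral)
      (auto simp: K_index_def K_term_def Kp_nth_0 Km_nth_0 one_series_def split: if_splits)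
  also have "\<dots> = one_series m"
    by (simp add: K_term_def Kp_nth_0 Km_nth_0 one_series_def)
  finally show ?thesis .
qed

lemma K_series_nth_1: "K_series Kp Km m $ Suc 0 = Kp m $ Suc 0 + Km m $ Suc 0"
proof (cases "m \<in> \<int>")
  case True
  then obtain i where i: "m = of_int i" by (elim Ints_cases)
  let ?x = "(nat (- i), nat i)"
  have "K_series Kp Km m $ Suc 0 = infsum (\<lambda>x. K_term Kp Km x $ Suc 0) {?x}"
    unfolding K_series_def hsum_def fps_nth_Abs_fps
    by (intro infsum_cong_neutral)
      (auto simp: i K_index_of_int K_term_def Kp_nth_0 Km_nth_0 one_series_def fps_mult_nth
        split: if_splits)
  also have "\<dots> = Kp m $ Suc 0 + Km m $ Suc 0"
  proof -
    consider "i = 0" | "i > 0" | "i < 0" by linarith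
    then show ?thesis
    proof cases
      case 2
      then have "- m \<notin> \<nat>" by (auto simp: i Nats_def)
      with 2 show ?thesis
        by (simp add: K_term_def i Kp_nth_0 Km_nth_0 one_series_def fps_mult_nth Km_modes)
    next
      case 3
      then have "m \<notin> \<nat>" by (auto simp: i Nats_def)
      with 3 show ?thesis
        by (simp add: K_term_def i Kp_nth_0 Km_nth_0 one_series_def fps_mult_nth Kp_modes)
    qed (simp add: K_term_def i Kp_nth_0 Km_nth_0 one_series_def fps_mult_nth add.commute)
  qed
  finally show ?thesis .
next
  case False
  then have "m \<notin> \<nat>" "- m \<notin> \<nat>"
    using Nats_subset_Ints Ints_minus[of "- m"] by auto
  with False show ?thesis
    by (simp add: K_series_not_Ints Kp_modes Km_modes)
qed

lemma Km_commutator: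
  fixes X :: "'a fps series"
  assumes X: "\<And>m n. Km m * X n = expand_zw (KG_factor u) X Km m n" and m: "m \<in> \<int>"
  shows "Km m $ Suc 0 * X n $ 0 - X n $ 0 * Km m $ Suc 0
    = (if m < 0 then 2 * u else if m = 0 then u else 0) *\<^sub>C (X (m + n) $ 0)"
proof (cases "m \<le> 0")
  case True
  define i where "i = nat (\<lfloor>- m\<rfloor>)"
  have i: "m = - real i" using m True by (auto simp: i_def elim!: Ints_cases)
  have "Km (m + real j) = 0" if "j > i" for j
    using that by (intro Km_modes) (auto simp: i Nats_def)
  then have "j \<le> i" if "X (n - real j) * Km (m + real j) \<noteq> 0" for j
    using that by (cases "j \<le> i") auto
  then have "{j. X (n - real j) * Km (m + real j) \<noteq> 0} \<subseteq> {..i}" by blast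
  then have fin: "finite {j. X (n - real j) * Km (m + real j) \<noteq> 0}" by (rule finite_subset) simp
  have "(Km m * X n) $ Suc 0 = (X n * Km m) $ Suc 0 + (KG_factor u $ i $ Suc 0) *\<^sub>C (X (n - real i) $ 0)"
    unfolding X
    by (subst expand_zw_nth_1[OF fin, where J="{i}"])
      (auto simp: KG_factor_nth Km_nth_0 one_series_def i)
  then show ?thesis
    using True by (auto simp: fps_mult_nth Km_nth_0 one_series_commute KG_factor_nth i algebra_simps)
next
  case False
  then have "Km m = 0" by (intro Km_modes) (auto simp: Nats_def)
  with False show ?thesis by simp
qed

lemma Kp_commutator:
  fixes X :: "'a fps series"
  assumes X: "\<And>m n. X m * Kp n = expand_zw (KG_factor u) Kp X m n" and n: "n \<in> \<int>"
  shows "X m $ 0 * Kp n $ Suc 0 - Kp n $ Suc 0 * X m $ 0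
    = (if n > 0 then 2 * u else if n = 0 then u else 0) *\<^sub>C (X (n + m) $ 0)"
proof (cases "n \<ge> 0")
  case True
  define i where "i = nat (\<lfloor>n\<rfloor>)"
  have i: "n = real i" using n True by (auto simp: i_def elim!: Ints_cases)
  have "Kp (n - real j) = 0" if "j > i" for j
    using that by (intro Kp_modes) (auto simp: i Nats_def)
  then have "j \<le> i" if "Kp (n - real j) * X (m + real j) \<noteq> 0" for j
    using that by (cases "j \<le> i") auto
  then have "{j. Kp (n - real j) * X (m + real j) \<noteq> 0} \<subseteq> {..i}" by blast
  then have fin: "finite {j. Kp (n - real j) * X (m + real j) \<noteq> 0}" by (rule finite_subset) simp
  have "(X m * Kp n) $ Suc 0 = (Kp n * X m) $ Suc 0 + (KG_factor u $ i $ Suc 0) *\<^sub>C (X (m + real i) $ 0)"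
    unfolding X
    by (subst expand_zw_nth_1[OF fin, where J="{i}"])
      (auto simp: KG_factor_nth Kp_nth_0 one_series_def i)
  then show ?thesis
    using True by (auto simp: fps_mult_nth Kp_nth_0 one_series_commute KG_factor_nth i algebra_simps)
next
  case False
  then have "Kp n = 0" by (intro Kp_modes) (auto simp: Nats_def)
  with False show ?thesis by simp
qed

lemma K_commutator:
  fixes X :: "'a fps series"
  assumes "\<And>m n. Km m * X n = expand_zw (KG_factor u) X Km m n"
    and "\<And>m n. X m * Kp n = expand_zw (KG_factor (- u)) Kp X m n"
    and m: "m \<in> \<int>"
  shows "K_series Kp Km m $ Suc 0 * X n $ 0 - X n $ 0 * K_series Kp Km m $ Suc 0
    = (2 * u) *\<^sub>C (X (m + n) $ 0)"
proof -
  have "K_series Kp Km m $ Suc 0 * X n $ 0 - X n $ 0 * K_series Kp Km m $ Suc 0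
    = (Km m $ Suc 0 * X n $ 0 - X n $ 0 * Km m $ Suc 0) - (X n $ 0 * Kp m $ Suc 0 - Kp m $ Suc 0 * X n $ 0)"
    by (simp add: K_series_nth_1 algebra_simps)
  also have "\<dots> = (2 * u) *\<^sub>C (X (m + n) $ 0)"
    unfolding Km_commutator[OF assms(1,3)] Kp_commutator[OF assms(2,3)]
    by (simp flip: scaleC.scale_left_diff_distrib)
  finally show ?thesis .
qed

lemma Gp_Gm_nth_0:
  assumes k: "k \<noteq> -1" and m: "m \<in> modes A"
  shows "4 *\<^sub>C (Gp m $ 0 * Gm n $ 0 + Gm n $ 0 * Gp m $ 0) =
      T (m + n) $ 2 + (1 / (k+1)) *\<^sub>C (K_series Kp Km (m + n) $ 2)
    + of_real (m - n) *\<^sub>C (K_series Kp Km (m + n) $ Suc 0)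
    + (2 * k * of_real m ^ 2 - k * (k+2) / (6 * (k+1))) *\<^sub>C one_series (m + n)"
proof -
  have k1: "k + 1 \<noteq> 0" using k by (simp add: eq_neg_iff_add_eq_0)
  define p where "p = m + n"
  define a b c where abc: "a = 4 * (k+1) * of_real m - 2 * (k+1) * of_real p"
    "b = 2 * (k+2) * of_real m" "c = 2 * (k+1) * of_real m - (k+1) * of_real p"
  let ?K = "K_series Kp Km p" and ?e = "one_series p :: 'a"
  define i2 where "i2 = inverse (qint (k+1)) $ 2"
  have i2: "i2 = - (k * (k+2) / (6 * (k+1)))"
    unfolding i2_def inverse_qint_nth(3)[OF k1] by (simp add: power2_eq_square algebra_simps)
  define f where "f = inverse (qint (k+1)) * qpow a"
  have eq: "(qdiff ^ 2) *\<^sub>h acomm Gp Gm m n =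
      f *\<^sub>h ?K - qpow b *\<^sub>h one_series p + qpow c *\<^sub>h T p"
    unfolding Gp_Gm using m
    by (simp add: qdelta_at_w_def qdelta_def dil_def hscale_hscale qpow_mult mult.assoc f_def abc p_def algebra_simps)
  have q2: "(qdiff ^ 2) $ 0 = 0" "(qdiff ^ 2) $ Suc 0 = 0" "(qdiff ^ 2) $ 2 = 4"
    by (simp_all only: power2_eq_square fps_mult_nth_2) (simp_all add: fps_mult_nth qdiff_nth)
  have a: "f $ 0 = 1 / (k+1)"
    "f $ Suc 0 = a / (k+1)"
    "f $ 2 = a\<^sup>2 / (2 * (k+1)) + i2"
    unfolding f_def by (simp_all only: fps_mult_nth_2)
      (simp_all add: fps_mult_nth inverse_qint_nth(1,2)[OF k1] i2_def del: fps_inverse_nth_0)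
  note simps = K_series_nth_0 one_series_nth q2 a
  have T0: "T p $ 0 = (k / (k+1)) *\<^sub>C ?e"
  proof -
    have "0 = (1 / (k+1)) *\<^sub>C ?e - 1 *\<^sub>C ?e + T p $ 0"
      using arg_cong[OF eq, of "\<lambda>f. f $ 0"] by (simp add: simps)
    then have "T p $ 0 = (1 - 1 / (k+1)) *\<^sub>C ?e"
      by (simp add: algebra_simps)
    also have "1 - 1 / (k+1) = k / (k+1)" using k1 by (simp add: field_simps)
    finally show ?thesis .
  qed
  have T1: "T p $ Suc 0 = - ((1 / (k+1)) *\<^sub>C (?K $ Suc 0))"
  proof -
    have "0 = (1 / (k+1)) *\<^sub>C (?K $ Suc 0) + (a / (k+1)) *\<^sub>C ?e - b *\<^sub>C ?e
        + T p $ Suc 0 + (c * (k / (k+1))) *\<^sub>C ?e"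
      using arg_cong[OF eq, of "\<lambda>f. f $ Suc 0"] by (simp add: simps T0 scaleC_scaleC algebra_simps)
    then have "T p $ Suc 0 = (b - a / (k+1) - c * (k / (k+1))) *\<^sub>C ?e - (1 / (k+1)) *\<^sub>C (?K $ Suc 0)"
      by (simp add: scaleC.scale_left_diff_distrib algebra_simps)
    also have "(b - a / (k+1) - c * (k / (k+1))) *\<^sub>C ?e = 0 *\<^sub>C ?e"
      using k1 by (intro scaleC_one_series) (simp add: abc field_simps)
    finally show ?thesis by simp
  qed
  have "4 *\<^sub>C (Gp m $ 0 * Gm n $ 0 + Gm n $ 0 * Gp m $ 0)
      = (1 / (k+1)) *\<^sub>C (?K $ 2) + (a / (k+1)) *\<^sub>C (?K $ Suc 0) + (a\<^sup>2 / (2 * (k+1)) + i2) *\<^sub>C ?e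
        - (b\<^sup>2 / 2) *\<^sub>C ?e + (T p $ 2 + c *\<^sub>C (T p $ Suc 0) + (c\<^sup>2 / 2) *\<^sub>C (T p $ 0))"
    using arg_cong[OF eq, of "\<lambda>f. f $ 2"] by (simp add: simps acomm_def scaleC_one)
  also have "\<dots> = T p $ 2 + (1 / (k+1)) *\<^sub>C (?K $ 2) + (a / (k+1) - c / (k+1)) *\<^sub>C (?K $ Suc 0)
      + (a\<^sup>2 / (2 * (k+1)) + i2 - b\<^sup>2 / 2 + c\<^sup>2 / 2 * (k / (k+1))) *\<^sub>C ?e"
    unfolding T0 T1
    by (simp add: scaleC_scaleC scaleC.scale_left_diff_distrib scaleC_add_left algebra_simps)
  also have "a / (k+1) - c / (k+1) = of_real (m - n)"
  proof -
    have "a - c = (k+1) * of_real (m - n)" by (simp add: abc p_def algebra_simps)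
    then show ?thesis using k1 by (simp flip: diff_divide_distrib)
  qed
  also have "(a\<^sup>2 / (2 * (k+1)) + i2 - b\<^sup>2 / 2 + c\<^sup>2 / 2 * (k / (k+1))) *\<^sub>C ?e
      = (2 * k * of_real m ^ 2 - k * (k+2) / (6 * (k+1))) *\<^sub>C ?e"
  proof (rule scaleC_one_series)
    assume "p = 0"
    then have abc0: "a = (k+1) * (4 * of_real m)" "c = (k+1) * (2 * of_real m)" by (simp_all add: abc)
    have "a\<^sup>2 / (2 * (k+1)) = 8 * (k+1) * of_real m ^ 2"
      "c\<^sup>2 / 2 * (k / (k+1)) = 2 * (k+1) * k * of_real m ^ 2"
    proof -
      have "(y * (4 * x))\<^sup>2 / (2 * y) = 8 * y * x\<^sup>2" "(y * (2 * x))\<^sup>2 / 2 * (k / y) = 2 * y * k * x\<^sup>2"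
        if "y \<noteq> 0" for x y :: complex
        using that by (simp_all add: power2_eq_square)
      from this[OF k1] show "a\<^sup>2 / (2 * (k+1)) = 8 * (k+1) * of_real m ^ 2"
        "c\<^sup>2 / 2 * (k / (k+1)) = 2 * (k+1) * k * of_real m ^ 2"
        unfolding abc0 by this+
    qed
    then show "a\<^sup>2 / (2 * (k+1)) + i2 - b\<^sup>2 / 2 + c\<^sup>2 / 2 * (k / (k+1))
        = 2 * k * of_real m ^ 2 - k * (k+2) / (6 * (k+1))"
      by (simp add: i2 abc(2) power2_eq_square algebra_simps)
  qed
  finally show ?thesis by (simp only: p_def)
qed

end

theorem theorem4p5:
  fixes k :: complex and A :: sector
    and Kp Km T Gp Gm :: "'a::complex_topological_algebra fps series"
    and H :: "int \<Rightarrow> 'a fps"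
  assumes "k \<noteq> -1" and "k \<noteq> -2"
    and "SVir_expansion k A Kp Km T Gp Gm H"
  shows "N2_superconformal A (3 * k / (k + 2))
           (sc_G k Gp) (sc_G k Gm) (sc_I k Kp Km) (sc_L k Kp Km T)"
proof -
  interpret SVir_expansion k A Kp Km T Gp Gm H by fact
  have k1: "k + 1 \<noteq> 0" and k2: "k + 2 \<noteq> 0"
    using assms(1,2) by (simp_all add: eq_neg_iff_add_eq_0)
  let ?s = "csqrt (2 / (k+2))"
  have sc_G_mult: "sc_G k X m * sc_G k Y n = (2 / (k+2)) *\<^sub>C (X m $ 0 * Y n $ 0)"
    for X Y :: "'a fps series" and m n
  proof -
    have "?s * ?s = 2 / (k+2)"
      unfolding power2_eq_square[symmetric] by (rule power2_csqrt)
    then show ?thesis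
      by (simp add: sc_G_def mult_scaleC_left mult_scaleC_right scaleC_scaleC)
  qed
  have I_G: "sc_I k Kp Km m * sc_G k X n - sc_G k X n * sc_I k Kp Km m
      = (u / (k+2)) *\<^sub>C sc_G k X (m + n)"
    if "\<And>m n. Km m * X n = expand_zw (KG_factor u) X Km m n"
      "\<And>m n. X m * Kp n = expand_zw (KG_factor (- u)) Kp X m n" "m \<in> \<int>" for X u m n
  proof -
    have "sc_I k Kp Km m * sc_G k X n - sc_G k X n * sc_I k Kp Km m
      = (?s / (2 * (k+2))) *\<^sub>C (K_series Kp Km m $ Suc 0 * X n $ 0 - X n $ 0 * K_series Kp Km m $ Suc 0)"
      by (simp add: sc_I_def sc_G_def mult_scaleC_left mult_scaleC_right scaleC_scaleC
          scaleC.scale_right_diff_distrib)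
    also have "\<dots> = (?s / (2 * (k+2)) * (2 * u)) *\<^sub>C (X (m + n) $ 0)"
      unfolding K_commutator[OF that] scaleC_scaleC ..
    also have "?s / (2 * (k+2)) * (2 * u) = u / (k+2) * ?s"
    proof -
      have "x / (2 * y) * (2 * u) = u / y * x" for x y :: complex by simp
      then show ?thesis .
    qed
    also have "\<dots> *\<^sub>C (X (m + n) $ 0) = (u / (k+2)) *\<^sub>C sc_G k X (m + n)"
      by (simp add: sc_G_def scaleC_scaleC)
    finally show ?thesis .
  qed
  have zero: "X m $ 0 * X n $ 0 + X n $ 0 * X m $ 0 = 0" if "acomm X X m n = 0" for X :: "'a fps series" and m n
    using arg_cong[OF that, of "\<lambda>f. f $ 0"] by (simp add: acomm_def)
  have "N2_superconformal A (3 * (k / (k + 2)))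
           (sc_G k Gp) (sc_G k Gm) (sc_I k Kp Km) (sc_L k Kp Km T)"
  proof (rule N2_superconformal_from_G)
    fix m n :: real
    show "m \<notin> modes A \<Longrightarrow> sc_G k Gp m = 0" "m \<notin> modes A \<Longrightarrow> sc_G k Gm m = 0"
      by (simp_all add: sc_G_def Gp_modes Gm_modes)
    show "m \<notin> \<int> \<Longrightarrow> sc_I k Kp Km m = 0"
      by (simp add: sc_I_def K_series_not_Ints)
    show "m \<notin> \<int> \<Longrightarrow> sc_L k Kp Km T m = 0"
      by (auto simp: sc_L_def K_series_not_Ints T_modes one_series_def)
    show "sc_G k Gp m * sc_G k Gp n + sc_G k Gp n * sc_G k Gp m = 0"
      "sc_G k Gm m * sc_G k Gm n + sc_G k Gm n * sc_G k Gm m = 0"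
      unfolding sc_G_mult by (simp_all add: zero Gp_Gp Gm_Gm flip: scaleC_add_right)
    show "sc_I k Kp Km m * sc_G k Gp n - sc_G k Gp n * sc_I k Kp Km m = sc_G k Gp (m + n)" if "m \<in> \<int>"
      using I_G[OF Km_Gp Gp_Kp that] k2 by (simp add: scaleC_one)
    show "sc_I k Kp Km m * sc_G k Gm n - sc_G k Gm n * sc_I k Kp Km m = - sc_G k Gm (m + n)" if "m \<in> \<int>"
    proof -
      have "sc_I k Kp Km m * sc_G k Gm n - sc_G k Gm n * sc_I k Kp Km m
          = (- (k+2) / (k+2)) *\<^sub>C sc_G k Gm (m + n)"
        by (rule I_G[OF Km_Gm _ that]) (simp only: Gm_Kp minus_minus)
      also have "- (k+2) / (k+2) = - 1" using divide_self[OF k2] by (simp only: divide_minus_left)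
      finally show ?thesis by (simp add: scaleC_one)
    qed
    show "sc_G k Gp m * sc_G k Gm n + sc_G k Gm n * sc_G k Gp m
        = 2 *\<^sub>C sc_L k Kp Km T (m + n) + of_real (m - n) *\<^sub>C sc_I k Kp Km (m + n)
          + (k / (k+2) * (of_real m ^ 2 - 1/4)) *\<^sub>C one_series (m + n)"
      if m: "m \<in> modes A"
    proof -
      have c0: "2 / y = 1 / (2 * y) * 4" and c1: "1 / (2 * y) = 2 * (1 / (4 * y))"
        and c2: "1 / (2 * y) * (1 / x) = 2 * (1 / (4 * x * y))"
        and c3: "1 / (2 * y) * x = x * (1 / (2 * y))" for x y :: complex
        by simp_all
      have "1 / (2 * y) * (2 * k * x - k * y / (6 * z)) = 2 * (k * (3 * z - y) / (24 * z * y)) + k / y * (x - 1/4)"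
        if "y \<noteq> 0" "z \<noteq> 0" for x y z
        using that by (simp add: field_simps)
      note * = this[OF k2 k1]
      have c4: "1 / (2 * (k+2)) * (2 * k * x - k * (k+2) / (6 * (k+1)))
          = 2 * (k*(2*k+1) / (24*(k+1)*(k+2))) + k / (k+2) * (x - 1/4)" for x
      proof -
        have "3 * (k+1) - (k+2) = 2*k+1" by simp
        with * show ?thesis by (simp only:)
      qed
      have "sc_G k Gp m * sc_G k Gm n + sc_G k Gm n * sc_G k Gp m
        = (1 / (2 * (k+2))) *\<^sub>C 4 *\<^sub>C (Gp m $ 0 * Gm n $ 0 + Gm n $ 0 * Gp m $ 0)"
        unfolding sc_G_mult c0 by (simp only: scaleC_add_right scaleC_scaleC)
      also have "\<dots> = (1 / (2 * (k+2))) *\<^sub>C (T (m + n) $ 2) + (1 / (2 * (k+2)) * (1 / (k+1))) *\<^sub>C (K_series Kp Km (m + n) $ 2)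
          + (1 / (2 * (k+2)) * of_real (m - n)) *\<^sub>C (K_series Kp Km (m + n) $ Suc 0)
          + (1 / (2 * (k+2)) * (2 * k * of_real m ^ 2 - k * (k+2) / (6 * (k+1)))) *\<^sub>C one_series (m + n)"
        unfolding Gp_Gm_nth_0[OF assms(1) m] by (simp only: scaleC_add_right scaleC_scaleC)
      also have "\<dots> = (2 * (1 / (4 * (k+2)))) *\<^sub>C (T (m + n) $ 2) + (2 * (1 / (4*(k+1)*(k+2)))) *\<^sub>C (K_series Kp Km (m + n) $ 2)
          + (of_real (m - n) * (1 / (2*(k+2)))) *\<^sub>C (K_series Kp Km (m + n) $ Suc 0)
          + (2 * (k*(2*k+1) / (24*(k+1)*(k+2))) + k / (k+2) * (of_real m ^ 2 - 1/4)) *\<^sub>C one_series (m + n)"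
        by (intro arg_cong2[where f="(+)"] arg_cong2[where f="(*\<^sub>C)"] refl c1 c2 c3 c4)
      finally show ?thesis
        by (simp only: sc_L_def sc_I_def scaleC_add_right scaleC_add_left scaleC_scaleC ac_simps One_nat_def)
    qed
  qed
  then show ?thesis by simp
qed

end
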